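(* Let $\{A(t)\}_{t\ge0}$ be a time-invariant continuous time chain, i.e. $A(t)=\hat A$ for all $t\ge0$, where $\hat A$ is a fixed real $N\times N$ matrix with zero row sums and non-negative off-diagonal entries. Then $\mathbf{rank}(A)$ equals the size of the smallest s-root of the unbounded interactions graph associated with $\{A(t)\}$.
   Context: Let $\mathcal V=\{1,\dots,N\}$ and write $A(t)=(a_{ij}(t))$. The state transition matrix of $\dot x(t)=\hat A x(t)$ is $\Phi(t,\tau)=e^{\hat A(t-\tau)}$, $t\ge\tau\ge0$. Rank of the chain (not the matrix rank of $\hat A$): for $\tau\ge0$ let $\mathbf{null}_\tau(A)=\{v\in\mathbb R^N : \lim_{t\to\infty}\Phi(t,\tau)v=\mathbf 0_N\}$. This is a vector space whose dimension does not depend on $\tau$; this dimension is $\mathbf{nullity}(A)$, and $\mathbf{rank}(A)=N-\mathbf{nullity}(A)$. Unbounded interactions graph: the directed graph $\mathcal H_1(\mathcal V,\mathcal E_1)$ on $\mathcal V$ in which, for distinct $i,j\in\mathcal V$, $(i,j)\in\mathcal E_1$ (a link from $i$ to $j$) if and only if $\int_0^\infty a_{ji}(t)\,dt=\infty$. s-root: a subset $\mathcal S'\subset\mathcal V$ such that for every $i\in\mathcal V$, either $i\in\mathcal S'$ or there is $j\in\mathcal S'$ such that $i$ is reachable from $j$ by a directed path in $\mathcal H_1$. *)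

theory Defs
  imports "HOL-Analysis.Analysis"
begin

(* Multiplication on the type real^'n^'n is componentwise and the type is no normed algebra,
   so neither the library power nor the library exp is the matrix one. *)
definition matrix_power :: "real^'n^'n \<Rightarrow> nat \<Rightarrow> real^'n^'n" where
  "matrix_power M k = (((**) M) ^^ k) (mat 1)"

definition matrix_exp :: "real^'n^'n \<Rightarrow> real^'n^'n" where
  "matrix_exp M = (\<Sum>k. (1 / fact k) *\<^sub>R matrix_power M k)"

definition state_transition :: "real^'n^'n \<Rightarrow> real \<Rightarrow> real \<Rightarrow> real^'n^'n" where
  "state_transition Ahat t \<tau> = matrix_exp ((t - \<tau>) *\<^sub>R Ahat)"

definition null_at :: "real^'n^'n \<Rightarrow> real \<Rightarrow> (real^'n) set" where
  "null_at Ahat \<tau> = {v. ((\<lambda>t. state_transition Ahat t \<tau> *v v) \<longlongrightarrow> 0) at_top}"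

(* The choice of initial time 0 is immaterial: see null_at_eq and dim_null_at below. *)
definition chain_nullity :: "real^'n^'n \<Rightarrow> nat" where
  "chain_nullity Ahat = dim (null_at Ahat 0)"

definition chain_rank :: "real^'n^'n \<Rightarrow> nat" where
  "chain_rank Ahat = CARD('n) - chain_nullity Ahat"

(* A link from i to j concerns the (j,i) entry. The ennreal coercion truncates negative values;
   this is harmless for chains, whose off-diagonal entries are non-negative. *)
definition unbounded_interactions_graph :: "(real \<Rightarrow> real^'n^'n) \<Rightarrow> ('n \<times> 'n) set" where
  "unbounded_interactions_graph A =
     {(i, j). i \<noteq> j \<and> (\<integral>\<^sup>+t\<in>{0..}. ennreal (A t $ j $ i) \<partial>lborel) = \<infinity>}"

definition s_root :: "('n \<times> 'n) set \<Rightarrow> 'n set \<Rightarrow> bool" where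
  "s_root E S \<longleftrightarrow> (\<forall>i. i \<in> S \<or> (\<exists>j\<in>S. (j, i) \<in> E\<^sup>+))"

definition smallest_s_root_size :: "('n::finite \<times> 'n) set \<Rightarrow> nat" where
  "smallest_s_root_size E = Min {card S |S. s_root E S}"

lemma s_root_UNIV: "s_root E UNIV"
  by (simp add: s_root_def)

lemma smallest_s_root_size_attained:
  fixes E :: "('n::finite \<times> 'n) set"
  shows "\<exists>S. s_root E S \<and> card S = smallest_s_root_size E"
    and "s_root E S \<Longrightarrow> smallest_s_root_size E \<le> card S"
proof -
  have fin: "finite {card S |S. s_root E S}"
    by (rule finite_subset[of _ "range card"]) auto
  have "{card S |S. s_root E S} \<noteq> {}"
    using s_root_UNIV by blast
  from Min_in[OF fin this] show "\<exists>S. s_root E S \<and> card S = smallest_s_root_size E"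
    unfolding smallest_s_root_size_def by force
  show "s_root E S \<Longrightarrow> smallest_s_root_size E \<le> card S"
    unfolding smallest_s_root_size_def using Min_le[OF fin] by blast
qed

lemma matrix_exp_summable:
  fixes M :: "real^'n^'n"
  shows "summable (\<lambda>k. (1 / fact k) *\<^sub>R matrix_power M k)"
proof -
  have "linear (\<lambda>X::real^'n^'n. M ** X)"
    by (intro linearI matrix_add_ldistrib)
      (simp add: vec_eq_iff matrix_matrix_mult_def sum_distrib_left mult.left_commute)
  then obtain K where K: "K > 0" "\<And>X::real^'n^'n. norm (M ** X) \<le> K * norm X"
    by (rule linear_bounded_pos) (rule that)
  have bound: "norm (matrix_power M k) \<le> K ^ k * norm (mat 1 :: real^'n^'n)" for k
  proof (induction k)
    case (Suc k)
    have "norm (matrix_power M (Suc k)) \<le> K * norm (matrix_power M k)"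
      using K(2) by (simp add: matrix_power_def)
    also have "\<dots> \<le> K * (K ^ k * norm (mat 1 :: real^'n^'n))"
      using Suc K(1) by (intro mult_left_mono) auto
    finally show ?case by (simp add: mult.assoc)
  qed (simp add: matrix_power_def)
  have "summable (\<lambda>k. (inverse (fact k) * K ^ k) * norm (mat 1 :: real^'n^'n))"
    by (intro summable_mult2 summable_exp)
  then show ?thesis
  proof (rule summable_comparison_test')
    show "norm ((1 / fact k) *\<^sub>R matrix_power M k)
        \<le> (inverse (fact k) * K ^ k) * norm (mat 1 :: real^'n^'n)" if "k \<ge> 0" for k
      using mult_left_mono[OF bound[of k], of "inverse (fact k)"]
      by (simp add: field_simps)
  qed
qed

lemma subspace_null_at: "subspace (null_at Ahat \<tau>)"
proof (rule subspaceI)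
  show "0 \<in> null_at Ahat \<tau>"
    by (simp add: null_at_def)
  fix x y and c :: real
  assume x: "x \<in> null_at Ahat \<tau>"
  then show "c *\<^sub>R x \<in> null_at Ahat \<tau>"
    unfolding null_at_def mem_Collect_eq matrix_vector_mult_scaleR
    by (rule tendsto_scaleR[OF tendsto_const, where b = 0, unfolded scaleR_zero_right])
  assume "y \<in> null_at Ahat \<tau>"
  with x show "x + y \<in> null_at Ahat \<tau>"
    unfolding null_at_def mem_Collect_eq matrix_vector_right_distrib
    by (rule tendsto_add_zero)
qed

lemma null_at_eq: "null_at Ahat \<tau> = null_at Ahat 0"
proof -
  define f where "f = (\<lambda>v t. matrix_exp (t *\<^sub>R Ahat) *v v)"
  have "((\<lambda>t. f v (t - \<tau>)) \<longlongrightarrow> 0) at_top \<longleftrightarrow> (f v \<longlongrightarrow> 0) at_top" for v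
  proof
    assume "((\<lambda>t. f v (t - \<tau>)) \<longlongrightarrow> 0) at_top"
    moreover have "filterlim (\<lambda>t::real. \<tau> + t) at_top at_top"
      by (intro filterlim_tendsto_add_at_top[OF tendsto_const] filterlim_ident)
    ultimately have "((\<lambda>t. f v ((\<tau> + t) - \<tau>)) \<longlongrightarrow> 0) at_top"
      by (rule filterlim_compose)
    then show "(f v \<longlongrightarrow> 0) at_top" by simp
  next
    assume "(f v \<longlongrightarrow> 0) at_top"
    moreover have "filterlim (\<lambda>t::real. - \<tau> + t) at_top at_top"
      by (intro filterlim_tendsto_add_at_top[OF tendsto_const] filterlim_ident)
    ultimately have "((\<lambda>t. f v (- \<tau> + t)) \<longlongrightarrow> 0) at_top"
      by (rule filterlim_compose)
    then show "((\<lambda>t. f v (t - \<tau>)) \<longlongrightarrow> 0) at_top" by simp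
  qed
  then show ?thesis
    by (simp only: null_at_def state_transition_def f_def diff_zero)
qed

lemma dim_null_at: "dim (null_at Ahat \<tau>) = chain_nullity Ahat"
  by (metis chain_nullity_def null_at_eq)

end

theory Submission
  imports Defs
begin

text \<open>
  Write \<open>L\<close> for the generator. Choosing \<open>c\<close> large, \<open>Q = L + c I\<close> is non-negative with row sums
  \<open>c\<close>, and \<open>exp (t L) = exp (- c t) exp (t Q)\<close>, so that \<open>exp (t L) L v\<close> is an expectation of
  \<open>Q\<^sup>k v / c\<^sup>k\<close> weighted with \<open>k / t - c\<close>, for \<open>k\<close> Poisson distributed with mean \<open>c t\<close>. The variance
  of the Poisson distribution makes this \<open>O(1 / sqrt t)\<close>. Hence the null space is exactly the range
  of \<open>L\<close>, and the rank of the chain is the dimension of the kernel of \<open>L\<close>. If \<open>S\<close> is an s-root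
  of least size, then every ancestor of \<open>s \<in> S\<close> is reachable from \<open>s\<close> and lies outside \<open>S - {s}\<close>.
  By the maximum principle, the Dirichlet problem \<open>v = g\<close> on \<open>S\<close>, \<open>L v = 0\<close> off \<open>S\<close> is uniquely
  solvable, and its solution is constant on the ancestors of each \<open>s \<in> S\<close>, hence lies in the kernel.
  So the kernel is isomorphic to the space of functions on \<open>S\<close>.
\<close>

section \<open>Exponential series of matrices\<close>

lemma matrix_power_mult_vec: "matrix_power M k *v v = ((*v) M ^^ k) v"
  by (induction k) (simp_all add: matrix_power_def matrix_vector_mul_assoc[symmetric])

lemma matrix_power_scaleR: "matrix_power (t *\<^sub>R M) k = t ^ k *\<^sub>R matrix_power M k"
  by (induction k)
    (simp_all add: matrix_power_def scalar_matrix_assoc[symmetric] matrix_scalar_ac)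

lemma matrix_exp_mult_vec_sums:
  fixes M :: "real^'n^'n"
  shows "(\<lambda>k. (t ^ k / fact k) *\<^sub>R ((*v) M ^^ k) v) sums (matrix_exp (t *\<^sub>R M) *v v)"
proof -
  have "bounded_linear (\<lambda>X::real^'n^'n. X *v v)"
    by (intro linear_conv_bounded_linear[THEN iffD1] linearI)
      (simp_all add: matrix_vector_mult_add_rdistrib scaleR_matrix_vector_assoc)
  from bounded_linear.sums[OF this summable_sums[OF matrix_exp_summable[of "t *\<^sub>R M"]]]
  show ?thesis
    by (simp add: matrix_exp_def matrix_power_scaleR matrix_power_mult_vec
        scaleR_matrix_vector_assoc[symmetric])
qed

text \<open>The kernel is the orthogonal complement of the row space, and row rank equals column
  rank.\<close>

lemma rank_nullity_matrix:
  fixes M :: "real^'n^'m"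
  shows "dim (range ((*v) M)) + dim {v. M *v v = 0} = CARD('n)"
proof -
  have null: "M *v v = 0 \<longleftrightarrow> (\<forall>r\<in>rows M. orthogonal r v)" for v
    by (auto simp: rows_def row_def orthogonal_def vec_eq_iff matrix_vector_mult_def inner_vec_def)
  have "{v. M *v v = 0} = {v \<in> UNIV. \<forall>r\<in>span (rows M). orthogonal r v}"
    using null by (auto intro: span_base simp: orthogonal_commute[of _ "_ :: real^'n"] orthogonal_to_span)
  moreover have "dim {v \<in> UNIV. \<forall>r\<in>span (rows M). orthogonal r v} + dim (span (rows M))
      = dim (UNIV :: (real^'n) set)"
    by (rule dim_subspace_orthogonal_to_vectors) auto
  moreover have "dim (range ((*v) M)) = dim (rows M)"
    by (metis rank_dim_range row_rank_def dim_vec_eq)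
  ultimately show ?thesis
    by simp
qed

text \<open>Every term of the exponential series beyond the zeroth lies in the range, which is
  closed. So \<open>exp (t M) v - v\<close> stays in the range, and on the null space it tends to
  \<open>- v\<close>. No property of generators enters here.\<close>

lemma null_at_subset_range: "null_at M 0 \<subseteq> range ((*v) M)"
proof
  fix v
  assume "v \<in> null_at M 0"
  then have lim: "((\<lambda>t. matrix_exp (t *\<^sub>R M) *v v) \<longlongrightarrow> 0) at_top"
    by (simp add: null_at_def state_transition_def)
  have sub: "subspace (range ((*v) M))"
    by (simp add: linear_subspace_image)
  then have closed: "closed (range ((*v) M))"
    by (rule closed_subspace)
  have "matrix_exp (t *\<^sub>R M) *v v - v \<in> range ((*v) M)" for t
  proof -
    have "(\<lambda>k. (t ^ Suc k / fact (Suc k)) *\<^sub>R ((*v) M ^^ Suc k) v)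
        sums (matrix_exp (t *\<^sub>R M) *v v - v)"
      using matrix_exp_mult_vec_sums[of t M v] by (subst sums_Suc_iff) simp
    moreover have "(\<Sum>k<n. (t ^ Suc k / fact (Suc k)) *\<^sub>R ((*v) M ^^ Suc k) v) \<in> range ((*v) M)" for n
      by (intro subspace_sum[OF sub] subspace_scale[OF sub]) auto
    ultimately show ?thesis
      unfolding sums_def using closed by (intro Lim_in_closed_set[of _ _ sequentially]) auto
  qed
  moreover have "((\<lambda>t. matrix_exp (t *\<^sub>R M) *v v - v) \<longlongrightarrow> 0 - v) at_top"
    by (intro tendsto_diff lim tendsto_const)
  ultimately have "- v \<in> range ((*v) M)"
    using closed by (intro Lim_in_closed_set[of _ _ at_top]) auto
  then have "- (- v) \<in> range ((*v) M)"
    by (rule subspace_neg[OF sub])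
  then show "v \<in> range ((*v) M)"
    by simp
qed

text \<open>The binomial theorem for the commuting summands \<open>Q\<close> and
  \<open>- c I\<close>, divided by \<open>fact k\<close>: the coefficient form of
  \<open>exp (t L) = exp (t Q) exp (- c t)\<close>.\<close>

lemma matrix_shift_power:
  fixes L Q :: "real^'n^'n"
  assumes Q: "\<And>v. Q *v v = L *v v + c *\<^sub>R v"
  shows "(((*v) L ^^ k) v $ i) / fact k
    = (\<Sum>j\<le>k. (((*v) Q ^^ j) v $ i / fact j) * ((- c) ^ (k - j) / fact (k - j)))"
proof -
  define p where "p j = (1 / fact j) *\<^sub>R ((*v) Q ^^ j) v" for j
  define e where "e j = (- c) ^ j / fact j" for j
  have p: "Q *v p j = real (Suc j) *\<^sub>R p (Suc j)" for j
    by (simp add: p_def matrix_vector_mult_scaleR)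
  have e: "- c * e j = real (Suc j) * e (Suc j)" for j
    by (simp add: e_def)
  have "(1 / fact k) *\<^sub>R ((*v) L ^^ k) v = (\<Sum>j\<le>k. e (k - j) *\<^sub>R p j)"
  proof (induction k)
    case 0
    then show ?case by (simp add: p_def e_def)
  next
    case (Suc k)
    have "real (Suc k) *\<^sub>R (1 / fact (Suc k)) *\<^sub>R ((*v) L ^^ Suc k) v
        = L *v ((1 / fact k) *\<^sub>R ((*v) L ^^ k) v)"
      by (simp add: matrix_vector_mult_scaleR)
    also have "\<dots> = (\<Sum>j\<le>k. e (k - j) *\<^sub>R (L *v p j))"
      unfolding Suc.IH by (simp add: linear_sum[OF matrix_vector_mul_linear] matrix_vector_mult_scaleR)
    also have "\<dots> = (\<Sum>j\<le>k. e (k - j) *\<^sub>R real (Suc j) *\<^sub>R p (Suc j)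
        + (- c * e (k - j)) *\<^sub>R p j)"
    proof (intro sum.cong refl)
      fix j
      have "L *v p j = real (Suc j) *\<^sub>R p (Suc j) - c *\<^sub>R p j"
        by (metis p Q add_diff_cancel_right')
      then show "e (k - j) *\<^sub>R (L *v p j) = e (k - j) *\<^sub>R real (Suc j) *\<^sub>R p (Suc j)
          + (- c * e (k - j)) *\<^sub>R p j"
        by (simp add: scaleR_diff_right mult.commute del: of_nat_Suc)
    qed
    \<comment> \<open>As in the Leibniz rule, \<open>L\<close> raises either the index of
      \<open>p\<close> or that of \<open>e\<close>. Both sums then extend to \<open>Suc k\<close> by
      a term with coefficient zero, and the factors \<open>j\<close> and \<open>Suc k - j\<close>
      add up to \<open>Suc k\<close>.\<close>
    also have "\<dots> = (\<Sum>j\<le>k. (real (Suc j) * e (Suc k - Suc j)) *\<^sub>R p (Suc j))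
        + (\<Sum>j\<le>k. (real (Suc k - j) * e (Suc k - j)) *\<^sub>R p j)"
      unfolding sum.distrib e
      by (intro arg_cong2[of _ _ _ _ plus] sum.cong refl) (simp_all add: Suc_diff_le mult.commute)
    also have "(\<Sum>j\<le>k. (real (Suc j) * e (Suc k - Suc j)) *\<^sub>R p (Suc j))
        = (\<Sum>j\<le>Suc k. (real j * e (Suc k - j)) *\<^sub>R p j)"
      by (subst sum.atMost_Suc_shift) simp
    also have "(\<Sum>j\<le>k. (real (Suc k - j) * e (Suc k - j)) *\<^sub>R p j)
        = (\<Sum>j\<le>Suc k. (real (Suc k - j) * e (Suc k - j)) *\<^sub>R p j)"
      by simp
    also have "(\<Sum>j\<le>Suc k. (real j * e (Suc k - j)) *\<^sub>R p j)
        + (\<Sum>j\<le>Suc k. (real (Suc k - j) * e (Suc k - j)) *\<^sub>R p j)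
        = real (Suc k) *\<^sub>R (\<Sum>j\<le>Suc k. e (Suc k - j) *\<^sub>R p j)"
      unfolding sum.distrib[symmetric] scaleR_sum_right
    proof (intro sum.cong refl)
      fix j assume "j \<in> {..Suc k}"
      then have "real (Suc k) = real j + real (Suc k - j)"
        by (simp flip: of_nat_add)
      then show "(real j * e (Suc k - j)) *\<^sub>R p j + (real (Suc k - j) * e (Suc k - j)) *\<^sub>R p j
          = real (Suc k) *\<^sub>R e (Suc k - j) *\<^sub>R p j"
        by (simp only: scaleR_add_left scaleR_scaleR distrib_right)
    qed
    finally show ?case
      by (rule scaleR_left_imp_eq[rotated]) simp
  qed
  then have "((1 / fact k) *\<^sub>R ((*v) L ^^ k) v) $ i = (\<Sum>j\<le>k. e (k - j) *\<^sub>R p j) $ i"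
    by simp
  then show ?thesis
    by (simp add: p_def e_def mult.commute)
qed

section \<open>Moments of the Poisson distribution, with weights of total mass
  \<open>exp s\<close>\<close>

lemma exp_sums: "(\<lambda>k. x ^ k / fact k) sums exp (x::real)"
  using exp_converges[of x] by (simp add: divide_inverse mult.commute)

lemma poisson_weight_Suc: "s ^ Suc k / fact (Suc k) * real (Suc k) = s * (s ^ k / fact k)" for s :: real
  by simp

lemma poisson_mean: "(\<lambda>k. s ^ k / fact k * real k) sums (s * exp (s::real))"
proof -
  have "(\<lambda>k. s * (s ^ k / fact k)) sums (s * exp s)"
    by (intro sums_mult exp_sums)
  then have "(\<lambda>k. s ^ Suc k / fact (Suc k) * real (Suc k)) sums (s * exp s)"
    by (simp only: poisson_weight_Suc)
  then show ?thesis
    by (rule sums_Suc_imp[rotated]) simp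
qed

text \<open>Absorbing one factor \<open>k\<close> into the factorial reduces the second moment to
  the mean and the total mass; expanding the square then gives the variance.\<close>

lemma poisson_variance: "(\<lambda>k. s ^ k / fact k * (real k - s)\<^sup>2) sums (s * exp (s::real))"
proof -
  have "(\<lambda>k. s * (s ^ k / fact k * real k) + s * (s ^ k / fact k)) sums (s * (s * exp s) + s * exp s)"
    by (intro sums_add sums_mult exp_sums poisson_mean)
  moreover have "s ^ Suc k / fact (Suc k) * (real (Suc k))\<^sup>2
      = s * (s ^ k / fact k * real k) + s * (s ^ k / fact k)" for k
    by (simp only: power2_eq_square mult.assoc[symmetric] poisson_weight_Suc)
      (simp add: algebra_simps add_divide_distrib)
  ultimately have "(\<lambda>k. s ^ Suc k / fact (Suc k) * (real (Suc k))\<^sup>2) sums (s * (s * exp s) + s * exp s)"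
    by (simp only:)
  then have second: "(\<lambda>k. s ^ k / fact k * (real k)\<^sup>2) sums (s * (s * exp s) + s * exp s)"
    by (rule sums_Suc_imp[rotated]) simp
  have "(\<lambda>k. s ^ k / fact k * (real k)\<^sup>2 - 2 * s * (s ^ k / fact k * real k) + s\<^sup>2 * (s ^ k / fact k))
      sums (s * (s * exp s) + s * exp s - 2 * s * (s * exp s) + s\<^sup>2 * exp s)"
    by (intro sums_add sums_diff second sums_mult poisson_mean exp_sums)
  then show ?thesis
    by (simp add: power2_eq_square algebra_simps)
qed

section \<open>Least s-roots\<close>

lemma s_root_reach: "s_root E S \<Longrightarrow> \<exists>s\<in>S. (s, i) \<in> E\<^sup>*"
  unfolding s_root_def by (metis rtrancl.rtrancl_refl trancl_into_rtrancl)

text \<open>If another element of \<open>S\<close> reached \<open>s\<close>, it would reach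
  everything that \<open>s\<close> reaches, and \<open>S - {s}\<close> would be a smaller s-root.
  The element of \<open>S\<close> that reaches an ancestor \<open>j\<close> of \<open>s\<close> also
  reaches \<open>s\<close>, so it is \<open>s\<close> itself.\<close>

lemma smallest_s_root_ancestor:
  fixes E :: "('n::finite \<times> 'n) set"
  assumes S: "s_root E S" "card S = smallest_s_root_size E"
    and s: "s \<in> S" and j: "(j, s) \<in> E\<^sup>*"
  shows "(s, j) \<in> E\<^sup>*" and "j \<in> S \<Longrightarrow> j = s"
proof -
  have unique: "s' = s" if s': "s' \<in> S" "(s', s) \<in> E\<^sup>*" for s'
  proof (rule ccontr)
    assume "s' \<noteq> s"
    have "s_root E (S - {s})"
      unfolding s_root_def
    proof
      fix i
      obtain r where r: "r \<in> S" "(r, i) \<in> E\<^sup>*"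
        using s_root_reach[OF S(1)] by blast
      then have "\<exists>r\<in>S - {s}. (r, i) \<in> E\<^sup>*"
        using s' \<open>s' \<noteq> s\<close> by (metis DiffI singletonD rtrancl_trans)
      then show "i \<in> S - {s} \<or> (\<exists>r\<in>S - {s}. (r, i) \<in> E\<^sup>+)"
        by (metis rtranclD)
    qed
    then have "smallest_s_root_size E \<le> card (S - {s})"
      by (rule smallest_s_root_size_attained(2))
    moreover have "card (S - {s}) < card S"
      using s by (intro psubset_card_mono) auto
    ultimately show False
      using S(2) by simp
  qed
  obtain r where r: "r \<in> S" "(r, j) \<in> E\<^sup>*"
    using s_root_reach[OF S(1)] by blast
  with j have "r = s"
    using unique rtrancl_trans by metis
  with r show "(s, j) \<in> E\<^sup>*" by simp
  show "j = s" if "j \<in> S"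
    using unique that j by blast
qed

section \<open>Generators of stochastic semigroups\<close>

locale stochastic_generator =
  fixes L :: "real^'n^'n"
  assumes row_sum: "(\<Sum>j\<in>UNIV. L $ i $ j) = 0"
    and off_diagonal: "i \<noteq> j \<Longrightarrow> L $ i $ j \<ge> 0"
begin

lemma ex_nonneg_shift: "\<exists>c>0. \<forall>i j. 0 \<le> (L + mat c) $ i $ j"
proof -
  \<comment> \<open>The sum dominates each diagonal entry; the added 1 keeps \<open>c\<close>
    positive even for a zero diagonal.\<close>
  define c where "c = 1 + (\<Sum>i\<in>UNIV. \<bar>L $ i $ i\<bar>)"
  have "\<bar>L $ i $ i\<bar> \<le> (\<Sum>i\<in>UNIV. \<bar>L $ i $ i\<bar>)" for i
    by (rule member_le_sum) auto
  then have "0 \<le> L $ i $ i + c" for i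
    unfolding c_def by (smt (verit))
  moreover have "c > 0"
    unfolding c_def by (smt (verit) sum_nonneg abs_ge_zero)
  ultimately show ?thesis
    using off_diagonal by (intro exI[of _ c]) (auto simp: mat_def)
qed

lemma shift_mult_vec: "(L + mat c) *v v = L *v v + c *\<^sub>R v"
  by (simp add: matrix_vector_mult_add_rdistrib)
    (simp add: vec_eq_iff matrix_vector_mult_def mat_def if_distrib[of "\<lambda>x. x * _"] cong: if_cong)

lemma shift_row_sum: "(\<Sum>j\<in>UNIV. (L + mat c) $ i $ j) = c"
  by (simp add: sum.distrib row_sum mat_def)

text \<open>A non-negative matrix with row sums \<open>c\<close> expands the maximum norm by at most
  the factor \<open>c\<close>.\<close>

lemma shift_power_bound:
  assumes "\<And>i j. 0 \<le> (L + mat c) $ i $ j" "\<And>i. \<bar>v $ i\<bar> \<le> m"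
  shows "\<bar>((*v) (L + mat c) ^^ k) v $ i\<bar> \<le> c ^ k * m"
proof (induction k arbitrary: i)
  case 0
  then show ?case using assms by simp
next
  case (Suc k)
  let ?w = "((*v) (L + mat c) ^^ k) v"
  have "\<bar>((L + mat c) *v ?w) $ i\<bar> \<le> (\<Sum>j\<in>UNIV. \<bar>(L + mat c) $ i $ j * ?w $ j\<bar>)"
    unfolding matrix_vector_mult_def by (simp add: sum_abs del: vector_add_component)
  also have "\<dots> \<le> (\<Sum>j\<in>UNIV. (L + mat c) $ i $ j * (c ^ k * m))"
    using Suc assms by (intro sum_mono) (simp add: abs_mult mult_left_mono del: vector_add_component)
  also have "\<dots> = c * (c ^ k * m)"
    by (simp only: sum_distrib_right[symmetric] shift_row_sum)
  finally show ?case by (simp add: mult.assoc)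
qed

text \<open>Componentwise \<open>exp (t Q) = exp (c t) exp (t L)\<close>: the Cauchy product of the
  absolutely convergent series of \<open>exp (t Q) v\<close> and \<open>exp (- c t)\<close> is the
  series of \<open>exp (t L) v\<close>.\<close>

lemma exp_mult_vec_sums_shift:
  fixes v :: "real^'n"
  assumes Q: "\<And>i j. 0 \<le> (L + mat c) $ i $ j" and "t \<ge> 0"
  shows "(\<lambda>k. (t ^ k / fact k) * (((*v) (L + mat c) ^^ k) v $ i))
    sums (exp (c * t) * ((matrix_exp (t *\<^sub>R L) *v v) $ i))"
proof -
  let ?Q = "L + mat c"
  define m where "m = norm v"
  have m: "\<bar>v $ i\<bar> \<le> m" for i
    unfolding m_def using component_le_norm_cart by blast
  have bnd: "norm ((t ^ k / fact k) * (((*v) ?Q ^^ k) v $ i)) \<le> (c * t) ^ k / fact k * m" for k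
  proof -
    have "norm ((t ^ k / fact k) * (((*v) ?Q ^^ k) v $ i)) = t ^ k / fact k * \<bar>((*v) ?Q ^^ k) v $ i\<bar>"
      using \<open>t \<ge> 0\<close> by (simp add: abs_mult)
    also have "\<dots> \<le> t ^ k / fact k * (c ^ k * m)"
      using \<open>t \<ge> 0\<close> by (intro mult_left_mono shift_power_bound Q m) auto
    finally show ?thesis by (simp add: power_mult_distrib mult_ac)
  qed
  have sm: "summable (\<lambda>k. norm ((t ^ k / fact k) * (((*v) ?Q ^^ k) v $ i)))"
  proof (rule summable_comparison_test')
    show "summable (\<lambda>k. (c * t) ^ k / fact k * m)"
      by (intro summable_mult2 sums_summable[OF exp_sums])
    show "norm (norm ((t ^ k / fact k) * (((*v) ?Q ^^ k) v $ i))) \<le> (c * t) ^ k / fact k * m" if "k \<ge> 0" for k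
      using bnd[of k] by simp
  qed
  have se: "summable (\<lambda>k. norm ((- c * t) ^ k / fact k))"
    using summable_norm_exp[of "- c * t"] by (simp add: divide_inverse mult.commute)
  let ?S = "\<Sum>k. (t ^ k / fact k) * (((*v) ?Q ^^ k) v $ i)"
  have "(\<lambda>k. \<Sum>j\<le>k. ((t ^ j / fact j) * (((*v) ?Q ^^ j) v $ i)) * ((- c * t) ^ (k - j) / fact (k - j)))
      sums (?S * (\<Sum>k. (- c * t) ^ k / fact k))"
    by (rule Cauchy_product_sums[OF sm se])
  also have "(\<Sum>k. (- c * t) ^ k / fact k) = exp (- c * t)"
    using exp_sums sums_unique by metis
  also have "(\<lambda>k. \<Sum>j\<le>k. ((t ^ j / fact j) * (((*v) ?Q ^^ j) v $ i)) * ((- c * t) ^ (k - j) / fact (k - j)))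
      = (\<lambda>k. t ^ k / fact k * (((*v) L ^^ k) v $ i))"
  proof
    fix k
    have "(\<Sum>j\<le>k. ((t ^ j / fact j) * (((*v) ?Q ^^ j) v $ i)) * ((- c * t) ^ (k - j) / fact (k - j)))
      = (\<Sum>j\<le>k. t ^ k * ((((*v) ?Q ^^ j) v $ i / fact j) * ((- c) ^ (k - j) / fact (k - j))))"
    proof (intro sum.cong refl)
      fix j assume "j \<in> {..k}"
      then have "t ^ k = t ^ j * t ^ (k - j)"
        by (simp flip: power_add)
      then show "((t ^ j / fact j) * (((*v) ?Q ^^ j) v $ i)) * ((- c * t) ^ (k - j) / fact (k - j))
        = t ^ k * ((((*v) ?Q ^^ j) v $ i / fact j) * ((- c) ^ (k - j) / fact (k - j)))"
        by (simp only: power_mult_distrib) simp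
    qed
    also have "\<dots> = t ^ k * (((*v) L ^^ k) v $ i / fact k)"
      unfolding sum_distrib_left[symmetric] matrix_shift_power[of ?Q L c, OF shift_mult_vec] ..
    finally show "(\<Sum>j\<le>k. ((t ^ j / fact j) * (((*v) ?Q ^^ j) v $ i)) * ((- c * t) ^ (k - j) / fact (k - j)))
      = t ^ k / fact k * (((*v) L ^^ k) v $ i)"
      by simp
  qed
  finally have "(\<lambda>k. t ^ k / fact k * (((*v) L ^^ k) v $ i)) sums (?S * exp (- c * t))" .
  moreover have "(\<lambda>k. t ^ k / fact k * (((*v) L ^^ k) v $ i)) sums ((matrix_exp (t *\<^sub>R L) *v v) $ i)"
    using bounded_linear.sums[OF bounded_linear_vec_nth matrix_exp_mult_vec_sums[of t L v], of i]
    by simp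
  ultimately have "?S * exp (- c * t) = (matrix_exp (t *\<^sub>R L) *v v) $ i"
    by (rule sums_unique2)
  then have "?S = exp (c * t) * ((matrix_exp (t *\<^sub>R L) *v v) $ i)"
    by (auto simp: exp_minus field_simps)
  with summable_sums[OF summable_norm_cancel[OF sm]] show ?thesis
    by simp
qed

text \<open>Writing \<open>L v\<close> as \<open>Q v - c v\<close> and shifting the index in the
  \<open>Q v\<close> series gives the weights \<open>k / t - c\<close>. As \<open>q k\<close> is at
  most \<open>c ^ k * m\<close> in absolute value, the mean deviation of a Poisson variable of mean
  \<open>c t\<close> controls the sum.\<close>

lemma exp_range_bound:
  fixes v :: "real^'n"
  assumes Q: "\<And>i j. 0 \<le> (L + mat c) $ i $ j" and "c > 0" "t > 0"
  shows "\<bar>(matrix_exp (t *\<^sub>R L) *v (L *v v)) $ i\<bar> \<le> norm v * (c + 1) / 2 / sqrt t"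
proof -
  let ?Q = "L + mat c"
  define m where "m = norm v"
  define q where "q k = ((*v) ?Q ^^ k) v $ i" for k
  define E where "E = exp (c * t)"
  have m: "\<bar>v $ i\<bar> \<le> m" for i
    unfolding m_def using component_le_norm_cart by blast
  have qb: "\<bar>q k\<bar> \<le> c ^ k * m" for k
    unfolding q_def by (rule shift_power_bound[OF Q m])
  define x where "x = (matrix_exp (t *\<^sub>R L) *v (L *v v)) $ i"
  have v1: "(\<lambda>k. t ^ k / fact k * q k) sums (E * (matrix_exp (t *\<^sub>R L) *v v) $ i)"
    using exp_mult_vec_sums_shift[OF Q, of t v i] \<open>t > 0\<close> by (simp add: q_def E_def)
  have "((*v) ?Q ^^ k) (?Q *v v) $ i = q (Suc k)" for k
    unfolding q_def funpow_Suc_right by simp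
  then have "(\<lambda>k. t ^ k / fact k * q (Suc k)) sums (E * (matrix_exp (t *\<^sub>R L) *v (?Q *v v)) $ i)"
    using exp_mult_vec_sums_shift[OF Q, of t "?Q *v v" i] \<open>t > 0\<close> by (simp add: E_def)
  \<comment> \<open>Reindexing by one aligns this series with that of \<open>v\<close>, at the cost
    of the factor \<open>k / t\<close>; the new term at \<open>k = 0\<close> vanishes.\<close>
  moreover have "t ^ Suc k / fact (Suc k) * (real (Suc k) / t) * q (Suc k) = t ^ k / fact k * q (Suc k)" for k
    using \<open>t > 0\<close> poisson_weight_Suc[of t k] by (simp only: times_divide_eq_right) simp
  ultimately have "(\<lambda>k. t ^ Suc k / fact (Suc k) * (real (Suc k) / t) * q (Suc k))
      sums (E * (matrix_exp (t *\<^sub>R L) *v (?Q *v v)) $ i)"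
    by (simp only:)
  then have "(\<lambda>k. t ^ k / fact k * (real k / t) * q k) sums (E * (matrix_exp (t *\<^sub>R L) *v (?Q *v v)) $ i)"
    by (rule sums_Suc_imp[rotated]) simp
  then have "(\<lambda>k. t ^ k / fact k * (real k / t) * q k - c * (t ^ k / fact k * q k))
      sums (E * (matrix_exp (t *\<^sub>R L) *v (?Q *v v)) $ i - c * (E * (matrix_exp (t *\<^sub>R L) *v v) $ i))"
    by (intro sums_diff sums_mult v1)
  moreover have "t ^ k / fact k * (real k / t) * q k - c * (t ^ k / fact k * q k)
      = t ^ k / fact k * q k * (real k / t - c)" for k
    by (simp only: left_diff_distrib right_diff_distrib mult_ac)
  moreover have "E * (matrix_exp (t *\<^sub>R L) *v (?Q *v v)) $ i - c * (E * (matrix_exp (t *\<^sub>R L) *v v) $ i)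
      = E * x"
    unfolding shift_mult_vec
    by (simp add: x_def matrix_vector_right_distrib matrix_vector_mult_scaleR algebra_simps)
  ultimately have xs: "(\<lambda>k. t ^ k / fact k * q k * (real k / t - c)) sums (E * x)"
    by (simp only:)
  \<comment> \<open>A summable majorant with a square in place of the absolute deviation. The scale
    \<open>sqrt t\<close> balances the two parts: they sum to multiples of \<open>c / sqrt t\<close>
    and \<open>1 / sqrt t\<close>.\<close>
  define b where "b k = m / 2 * (1 / (t * sqrt t) * ((c * t) ^ k / fact k * (real k - c * t)\<^sup>2)
      + 1 / sqrt t * ((c * t) ^ k / fact k))" for k
  have bs: "b sums (m / 2 * (1 / (t * sqrt t) * (c * t * E) + 1 / sqrt t * E))"
    unfolding b_def E_def by (intro sums_mult sums_add poisson_variance exp_sums)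
  have le: "norm (t ^ k / fact k * q k * (real k / t - c)) \<le> b k" for k
  proof -
    define y where "y = \<bar>real k - c * t\<bar>"
    have "real k / t - c = (real k - c * t) / t"
      using \<open>t > 0\<close> by (simp add: field_simps)
    then have 1: "norm (t ^ k / fact k * q k * (real k / t - c)) = t ^ k / fact k * (y / t) * \<bar>q k\<bar>"
      using \<open>t > 0\<close> by (simp add: abs_mult y_def)
    \<comment> \<open>With \<open>r = sqrt t\<close>, this is \<open>(y - r)\<^sup>2 \<ge> 0\<close>
      divided by \<open>2 * r ^ 3\<close>.\<close>
    have am_gm: "y / t \<le> 1 / 2 * (1 / (t * sqrt t) * y\<^sup>2 + 1 / sqrt t)"
    proof -
      define r where "r = sqrt t"
      have "r > 0" "t = r * r"
        using \<open>t > 0\<close> by (simp_all add: r_def)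
      moreover have "0 \<le> (y - r)\<^sup>2"
        by simp
      then have "2 * y * r \<le> y\<^sup>2 + r * r"
        by (simp add: power2_eq_square algebra_simps)
      ultimately show ?thesis
        unfolding r_def[symmetric] by (simp add: field_simps power2_eq_square)
    qed
    have "t ^ k / fact k * (y / t) * \<bar>q k\<bar> \<le> t ^ k / fact k * (y / t) * (c ^ k * m)"
      using \<open>t > 0\<close> qb by (intro mult_left_mono) (auto simp: y_def)
    also have "\<dots> = (c * t) ^ k / fact k * m * (y / t)"
      by (simp add: power_mult_distrib)
    also have "\<dots> \<le> (c * t) ^ k / fact k * m * (1 / 2 * (1 / (t * sqrt t) * y\<^sup>2 + 1 / sqrt t))"
      using \<open>t > 0\<close> \<open>c > 0\<close> by (intro mult_left_mono am_gm) (auto simp: m_def)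
    also have "\<dots> = b k"
      by (simp add: b_def y_def algebra_simps)
    finally show ?thesis unfolding 1 .
  qed
  have "\<bar>E * x\<bar> \<le> (\<Sum>k. b k)"
    using norm_suminf_le[OF le sums_summable[OF bs]] xs by (simp add: sums_iff)
  also have "\<dots> = E * (m * (c + 1) / 2 / sqrt t)"
    using bs \<open>t > 0\<close> by (simp add: sums_iff field_simps)
  finally show ?thesis
    by (simp only: abs_mult x_def m_def E_def abs_exp_cancel mult_le_cancel_left_pos[OF exp_gt_zero])
qed

lemma null_at_eq_range: "null_at L 0 = range ((*v) L)"
proof (intro equalityI null_at_subset_range subsetI)
  fix w assume "w \<in> range ((*v) L)"
  then obtain v where w: "w = L *v v" by blast
  obtain c where c: "c > 0" "\<And>i j. 0 \<le> (L + mat c) $ i $ j"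
    using ex_nonneg_shift by blast
  have "((\<lambda>t. matrix_exp (t *\<^sub>R L) *v (L *v v)) \<longlongrightarrow> 0) at_top"
  proof (rule vec_tendstoI)
    fix i
    have "((\<lambda>t. norm v * (c + 1) / 2 / sqrt t) \<longlongrightarrow> 0) at_top"
      by (intro tendsto_divide_0[OF tendsto_const] filterlim_at_top_imp_at_infinity sqrt_at_top)
    moreover have "\<forall>\<^sub>F t in at_top. norm ((matrix_exp (t *\<^sub>R L) *v (L *v v)) $ i)
        \<le> norm v * (c + 1) / 2 / sqrt t"
      using eventually_gt_at_top[of 0]
      by eventually_elim (unfold real_norm_def, rule exp_range_bound[OF c(2,1)])
    ultimately have "((\<lambda>t. (matrix_exp (t *\<^sub>R L) *v (L *v v)) $ i) \<longlongrightarrow> 0) at_top"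
      by (rule Lim_null_comparison[rotated])
    then show "((\<lambda>t. (matrix_exp (t *\<^sub>R L) *v (L *v v)) $ i) \<longlongrightarrow> 0 $ i) at_top"
      by simp
  qed
  then show "w \<in> null_at L 0"
    by (simp add: w null_at_def state_transition_def)
qed

lemma chain_rank_eq_dim_kernel: "chain_rank L = dim {v. L *v v = 0}"
  using rank_nullity_matrix[of L]
  by (simp add: chain_rank_def chain_nullity_def null_at_eq_range)

section \<open>The Dirichlet problem on an s-root\<close>

text \<open>For a constant chain, an entry has infinite integral over time exactly when it is
  positive, so this is the unbounded interactions graph, with the same orientation.\<close>

definition links :: "('n \<times> 'n) set" where
  "links = {(j, i). j \<noteq> i \<and> L $ i $ j > 0}"

lemma not_link: "(j, i) \<notin> links \<Longrightarrow> j = i \<or> L $ i $ j = 0"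
  using off_diagonal[of i j] by (cases "j = i") (auto simp: links_def)

text \<open>Zero row sums allow \<open>v $ i\<close> to be subtracted; the diagonal entry, the only
  one that may be negative, then drops out.\<close>

lemma mult_vec_nth_diff: "(L *v v) $ i = (\<Sum>j\<in>UNIV. L $ i $ j * (v $ j - v $ i))"
  by (simp add: matrix_vector_mult_def right_diff_distrib sum_subtractf row_sum
      flip: sum_distrib_right)

text \<open>At a local maximum no term of the difference form is positive, so a vanishing sum makes
  every term vanish.\<close>

lemma links_max_eq:
  assumes "(L *v v) $ i = 0" "(j, i) \<in> links"
    and max: "\<And>k. (k, i) \<in> links \<Longrightarrow> v $ k \<le> v $ i"
  shows "v $ j = v $ i"
proof -
  have nonpos: "L $ i $ k * (v $ k - v $ i) \<le> 0" for k
  proof (cases "(k, i) \<in> links")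
    case True
    then show ?thesis
      using max by (simp add: links_def mult_nonneg_nonpos)
  next
    case False
    then show ?thesis
      using not_link by force
  qed
  have "(\<Sum>k\<in>UNIV. - (L $ i $ k * (v $ k - v $ i))) = 0"
    using assms(1) by (simp add: mult_vec_nth_diff sum_negf)
  then have "- (L $ i $ j * (v $ j - v $ i)) = 0"
    using nonpos by (subst (asm) sum_nonneg_eq_0_iff) auto
  then show ?thesis
    using assms(2) by (auto simp: links_def)
qed

text \<open>A maximum over \<open>C\<close> spreads backwards along a path from \<open>S\<close>
  until it meets the boundary. Closure of \<open>C\<close> under predecessors keeps the path inside
  \<open>C\<close>.\<close>

lemma maximum_principle:
  assumes closed: "\<And>i j. i \<in> C \<Longrightarrow> (j, i) \<in> links \<Longrightarrow> j \<in> C"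
    and reach: "\<And>i. i \<in> C \<Longrightarrow> \<exists>s\<in>S. (s, i) \<in> links\<^sup>*"
    and harmonic: "\<And>i. i \<in> C - S \<Longrightarrow> (L *v v) $ i = 0"
    and boundary: "\<And>i. i \<in> C \<inter> S \<Longrightarrow> v $ i \<le> m"
    and "i \<in> C"
  shows "v $ i \<le> m"
proof -
  define M where "M = Max ((\<lambda>i. v $ i) ` C)"
  have le: "v $ k \<le> M" if "k \<in> C" for k
    unfolding M_def using that by (intro Max_ge) auto
  have "M \<in> (\<lambda>i. v $ i) ` C"
    unfolding M_def using \<open>i \<in> C\<close> by (intro Max_in) auto
  then obtain k where k: "k \<in> C" "v $ k = M" by force
  then obtain s where s: "s \<in> S" "(s, k) \<in> links\<^sup>*"
    using reach by blast
  have "M \<le> m"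
  proof (rule ccontr)
    assume "\<not> M \<le> m"
    \<comment> \<open>A vertex of \<open>C\<close> with value \<open>M > m\<close> cannot lie in
      \<open>S\<close>, so harmonicity holds there and passes the value on to its
      predecessor.\<close>
    have "s \<in> C \<and> v $ s = M"
      using s(2)
    proof (induction rule: converse_rtrancl_induct)
      case base
      then show ?case using k by simp
    next
      case (step j l)
      then have "l \<notin> S"
        using boundary \<open>\<not> M \<le> m\<close> by force
      then have "(L *v v) $ l = 0"
        using harmonic step by blast
      then have "v $ j = v $ l"
        using step closed le by (intro links_max_eq) auto
      then show ?case
        using step closed by blast
    qed
    then show False
      using boundary s(1) \<open>\<not> M \<le> m\<close> by force
  qed
  with le[OF \<open>i \<in> C\<close>] show ?thesis by linarith
qed

lemma maximum_principle_eq: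
  assumes closed: "\<And>i j. i \<in> C \<Longrightarrow> (j, i) \<in> links \<Longrightarrow> j \<in> C"
    and reach: "\<And>i. i \<in> C \<Longrightarrow> \<exists>s\<in>S. (s, i) \<in> links\<^sup>*"
    and harmonic: "\<And>i. i \<in> C - S \<Longrightarrow> (L *v v) $ i = 0"
    and boundary: "\<And>i. i \<in> C \<inter> S \<Longrightarrow> v $ i = m"
    and "i \<in> C"
  shows "v $ i = m"
proof (rule antisym)
  show "v $ i \<le> m"
    using assms by (intro maximum_principle[of C S v m i]) auto
  have "(- v) $ i \<le> - m"
    using assms by (intro maximum_principle[of C S "- v" "- m" i])
      (auto simp: linear_neg[OF matrix_vector_mul_linear])
  then show "m \<le> v $ i" by simp
qed

text \<open>The ancestors of \<open>s\<close> meet \<open>S\<close> only in \<open>s\<close>, so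
  \<open>v\<close> is constant on them by the maximum principle. The value of \<open>L v\<close> at
  \<open>s\<close> involves only differences to predecessors of \<open>s\<close>, hence vanishes
  too.\<close>

lemma dirichlet_extends_to_kernel:
  assumes S: "s_root links S" "card S = smallest_s_root_size links"
    and harmonic: "\<And>i. i \<notin> S \<Longrightarrow> (L *v v) $ i = 0"
  shows "L *v v = 0"
proof -
  have "(L *v v) $ s = 0" if s: "s \<in> S" for s
  proof -
    have const: "v $ j = v $ s" if "(j, s) \<in> links\<^sup>*" for j
    proof (rule maximum_principle_eq[of "{j. (j, s) \<in> links\<^sup>*}" S])
      show "l \<in> {j. (j, s) \<in> links\<^sup>*}" if "k \<in> {j. (j, s) \<in> links\<^sup>*}" "(l, k) \<in> links" for k l
        using that by (auto intro: converse_rtrancl_into_rtrancl)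
      show "\<exists>r\<in>S. (r, k) \<in> links\<^sup>*" if "k \<in> {j. (j, s) \<in> links\<^sup>*}" for k
        using smallest_s_root_ancestor(1)[OF S s] that s by blast
      show "v $ k = v $ s" if "k \<in> {j. (j, s) \<in> links\<^sup>*} \<inter> S" for k
        using smallest_s_root_ancestor(2)[OF S s] that by auto
    qed (use harmonic that in auto)
    have "L $ s $ j * (v $ j - v $ s) = 0" for j
    proof (cases "(j, s) \<in> links")
      case True
      then have "v $ j = v $ s"
        by (intro const r_into_rtrancl)
      then show ?thesis by simp
    next
      case False
      then show ?thesis
        using not_link by force
    qed
    then show ?thesis
      by (simp only: mult_vec_nth_diff sum.neutral_const)
  qed
  then show ?thesis
    using harmonic by (auto simp: vec_eq_iff)
qed

lemma dim_kernel: "dim {v. L *v v = 0} = smallest_s_root_size links"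
proof -
  obtain S where S: "s_root links S" "card S = smallest_s_root_size links"
    using smallest_s_root_size_attained(1) by blast
  \<comment> \<open>The operator of the Dirichlet problem: boundary data on \<open>S\<close>, the
    equation off \<open>S\<close>. Uniqueness makes it injective, hence bijective in finite
    dimension, and it carries the kernel onto the vectors supported on \<open>S\<close>.\<close>
  define T where "T v = (\<chi> i. if i \<in> S then v $ i else (L *v v) $ i)" for v
  have T_nth: "T v $ i = (if i \<in> S then v $ i else (L *v v) $ i)" for v i
    by (simp add: T_def)
  have "linear T"
    by (intro linearI)
      (simp_all add: vec_eq_iff T_nth matrix_vector_right_distrib matrix_vector_mult_scaleR)
  have "v = 0" if "T v = 0" for v
  proof -
    have T0: "T v $ i = 0" for i using that by simp
    have "v $ i = 0" for i
    proof (rule maximum_principle_eq[of UNIV S])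
      show "\<exists>s\<in>S. (s, k) \<in> links\<^sup>*" for k
        by (rule s_root_reach[OF S(1)])
      show "(L *v v) $ k = 0" if "k \<in> UNIV - S" for k
        using T0[of k] that by (simp add: T_nth)
      show "v $ k = 0" if "k \<in> UNIV \<inter> S" for k
        using T0[of k] that by (simp add: T_nth)
    qed auto
    then show ?thesis by (simp add: vec_eq_iff)
  qed
  then have "inj T"
    using \<open>linear T\<close> linear_injective_0 by blast
  then have "surj T"
    using \<open>linear T\<close> linear_injective_imp_surjective by blast
  define W where "W = {w::real^'n. \<forall>i. i \<notin> S \<longrightarrow> w $ i = 0}"
  have "T ` {v. L *v v = 0} = W"
  proof (intro equalityI subsetI)
    fix w assume "w \<in> W"
    obtain v where v: "w = T v"
      using \<open>surj T\<close> by blast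
    have "(L *v v) $ i = 0" if "i \<notin> S" for i
      using \<open>w \<in> W\<close> that unfolding W_def v by (auto simp: T_nth dest!: spec[of _ i])
    then have "L *v v = 0"
      by (rule dirichlet_extends_to_kernel[OF S])
    then show "w \<in> T ` {v. L *v v = 0}"
      using v by blast
  qed (auto simp: W_def T_nth)
  then have "dim {v. L *v v = 0} = dim W"
    using dim_image_eq[OF \<open>linear T\<close>, of "{v. L *v v = 0}"] \<open>inj T\<close>
    by (metis inj_on_subset subset_UNIV)
  also have "\<dots> = card S"
    unfolding W_def using dim_substandard_cart[where 'a = real and d = S] by (simp add: dim_vec_eq)
  finally show ?thesis
    using S(2) by simp
qed

end

section \<open>The unbounded interactions graph\<close>

lemma emeasure_lborel_atLeast: "emeasure lborel {a::real..} = \<infinity>"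
proof -
  have "of_nat n \<le> emeasure lborel {a..}" for n
  proof -
    have "of_nat n = emeasure lborel {a..a + real n}"
      by (simp add: ennreal_of_nat_eq_real_of_nat)
    also have "\<dots> \<le> emeasure lborel {a..}"
      by (intro emeasure_mono) auto
    finally show ?thesis .
  qed
  then show ?thesis
    by (metis ennreal_Ex_less_of_nat infinity_ennreal_def leD top.not_eq_extremum)
qed

text \<open>Valid for negative \<open>x\<close> as well, since \<open>ennreal\<close> sends it to
  zero.\<close>

lemma nn_integral_const_atLeast_eq_top_iff:
  "(\<integral>\<^sup>+t\<in>{0::real..}. ennreal x \<partial>lborel) = \<infinity> \<longleftrightarrow> x > 0"
  by (auto simp: nn_integral_cmult_indicator emeasure_lborel_atLeast ennreal_mult_eq_top_iff ennreal_eq_0_iff)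

theorem corollary5:
  fixes A :: "real \<Rightarrow> real^'n^'n" and Ahat :: "real^'n^'n"
  assumes time_invariant: "\<And>t. t \<ge> 0 \<Longrightarrow> A t = Ahat"
    and zero_row_sums: "\<And>i. (\<Sum>j\<in>UNIV. Ahat $ i $ j) = 0"
    and off_diagonal_nonneg: "\<And>i j. i \<noteq> j \<Longrightarrow> Ahat $ i $ j \<ge> 0"
  shows "chain_rank Ahat = smallest_s_root_size (unbounded_interactions_graph A)"
proof -
  interpret stochastic_generator Ahat
    using zero_row_sums off_diagonal_nonneg by unfold_locales
  have "(\<integral>\<^sup>+t\<in>{0..}. ennreal (A t $ j $ i) \<partial>lborel)
      = (\<integral>\<^sup>+t\<in>{0::real..}. ennreal (Ahat $ j $ i) \<partial>lborel)" for i j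
    by (intro nn_integral_cong) (auto simp: time_invariant split: split_indicator)
  then have "unbounded_interactions_graph A = links"
    by (simp only: unbounded_interactions_graph_def links_def nn_integral_const_atLeast_eq_top_iff)
  then show ?thesis
    by (simp add: chain_rank_eq_dim_kernel dim_kernel)
qed

end
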